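(* Let $G=(V,E)$ be a finite bidirected graph with a set $T\subseteq V$ of terminals such that $(G,T)$ is inner Eulerian, i.e. $\deg^{\rm in}(v)=\deg^{\rm out}(v)$ for every $v\in V-T$. Then the maximum number $\nu_{G,T}$ of pairwise edge-disjoint $T$-paths in $G$ satisfies $$\nu_{G,T}=\frac12\sum_{s\in T}\lambda_{G,T}(s),$$ where, for $s\in T$, $\lambda_{G,T}(s)$ is the minimum of $|\delta(X)|$ over all sets $X\subseteq V$ with $X\cap T=\{s\}$.
   Context: A bidirected graph $G=(V,E)$ has three types of edges: (i) an ordinary directed edge, which leaves one of its ends and enters the other; (ii) an edge leaving both of its ends; (iii) an edge entering both of its ends. Parallel edges are allowed. Loops (edges whose two ends coincide) are allowed only of types (ii) and (iii). A non-loop edge entering $v$ contributes $1$ to $\deg^{\rm in}(v)$, and a loop of type (iii) at $v$ contributes $2$ to $\deg^{\rm in}(v)$. Similarly, a non-loop edge leaving $v$ contributes $1$ to $\deg^{\rm out}(v)$, and a loop of type (ii) at $v$ contributes $2$ to $\deg^{\rm out}(v)$. Nodes in $T$ are called terminals and nodes in $V-T$ are called inner. A walk from $s$ to $t$ is an alternating sequence $P=(s=v_0,e_1,v_1,\ldots,e_k,v_k=t)$ of nodes and edges such that each $e_i$ connects $v_{i-1}$ and $v_i$, and for each $i=1,\ldots,k-1$ the edges $e_i,e_{i+1}$ form a transit pair at $v_i$, i.e. one of them enters $v_i$ and the other leaves $v_i$. There is no condition on whether $e_1$ enters or leaves $s$, or whether $e_k$ enters or leaves $t$. A path is an edge-simple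 walk, i.e. a walk all of whose edges are different (nodes may be repeated). A $T$-path is a path whose two ends $v_0,v_k$ are distinct terminals and whose other nodes $v_1,\ldots,v_{k-1}$ are inner. For $X\subseteq V$, $\delta(X)$ denotes the set of edges with one end in $X$ and the other in $V-X$ (irrespective of direction). *)

theory Defs
  imports Complex_Main "HOL-Library.Multiset"
begin

datatype direction = Entering | Leaving

text \<open>
  An edge is an unordered pair of half-edges, i.e. a two-element multiset of nodes, each
  tagged with the direction of the edge at that end.  An ordinary edge from \<open>u\<close> to \<open>v\<close> is
  \<open>{#(u, Leaving), (v, Entering)#}\<close>, and a loop entering both of its ends is
  \<open>{#(v, Entering), (v, Entering)#}\<close>.  As edges are elements of an arbitrary type
  \<open>'e\<close>, parallel edges are possible.
\<close>

record ('v, 'e) bidirected_graph =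
  nodes :: "'v set"
  edges :: "'e set"
  halves :: "'e \<Rightarrow> ('v \<times> direction) multiset"

definition ends :: "('v, 'e) bidirected_graph \<Rightarrow> 'e \<Rightarrow> 'v multiset" where
  "ends G e = image_mset fst (halves G e)"

definition enters :: "('v, 'e) bidirected_graph \<Rightarrow> 'e \<Rightarrow> 'v \<Rightarrow> bool" where
  "enters G e v \<longleftrightarrow> (v, Entering) \<in># halves G e"

definition leaves :: "('v, 'e) bidirected_graph \<Rightarrow> 'e \<Rightarrow> 'v \<Rightarrow> bool" where
  "leaves G e v \<longleftrightarrow> (v, Leaving) \<in># halves G e"

definition is_loop :: "('v, 'e) bidirected_graph \<Rightarrow> 'e \<Rightarrow> bool" where
  "is_loop G e \<longleftrightarrow> (\<exists>v. ends G e = {#v, v#})"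

text \<open>The last condition excludes loops that are ordinary directed edges.\<close>

definition finite_bidirected_graph :: "('v, 'e) bidirected_graph \<Rightarrow> bool" where
  "finite_bidirected_graph G \<longleftrightarrow>
     finite (nodes G) \<and> finite (edges G) \<and>
     (\<forall>e\<in>edges G. size (halves G e) = 2 \<and> set_mset (ends G e) \<subseteq> nodes G \<and>
        (is_loop G e \<longrightarrow> \<not> (\<exists>v. enters G e v \<and> leaves G e v)))"

definition deg_in :: "('v, 'e) bidirected_graph \<Rightarrow> 'v \<Rightarrow> nat" where
  "deg_in G v = card {e \<in> edges G. \<not> is_loop G e \<and> enters G e v}
     + 2 * card {e \<in> edges G. is_loop G e \<and> enters G e v}"

definition deg_out :: "('v, 'e) bidirected_graph \<Rightarrow> 'v \<Rightarrow> nat" where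
  "deg_out G v = card {e \<in> edges G. \<not> is_loop G e \<and> leaves G e v}
     + 2 * card {e \<in> edges G. is_loop G e \<and> leaves G e v}"

definition inner_Eulerian :: "('v, 'e) bidirected_graph \<Rightarrow> 'v set \<Rightarrow> bool" where
  "inner_Eulerian G T \<longleftrightarrow> (\<forall>v \<in> nodes G - T. deg_in G v = deg_out G v)"

definition transit_pair :: "('v, 'e) bidirected_graph \<Rightarrow> 'v \<Rightarrow> 'e \<Rightarrow> 'e \<Rightarrow> bool" where
  "transit_pair G v e e' \<longleftrightarrow>
     enters G e v \<and> leaves G e' v \<or> leaves G e v \<and> enters G e' v"

text \<open>
  A walk \<open>(v\<^sub>0, e\<^sub>1, v\<^sub>1, \<dots>, e\<^sub>k, v\<^sub>k)\<close> is given by its list of nodes and its list of edges;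
  since lists are indexed from zero, \<open>e\<^sub>i\<close> is \<open>es ! (i - 1)\<close>.
\<close>

definition is_walk :: "('v, 'e) bidirected_graph \<Rightarrow> 'v list \<Rightarrow> 'e list \<Rightarrow> bool" where
  "is_walk G vs es \<longleftrightarrow>
     length vs = length es + 1 \<and> set vs \<subseteq> nodes G \<and> set es \<subseteq> edges G \<and>
     (\<forall>i \<in> {1..length es}. ends G (es ! (i - 1)) = {#vs ! (i - 1), vs ! i#}) \<and>
     (\<forall>i \<in> {1..<length es}. transit_pair G (vs ! i) (es ! (i - 1)) (es ! i))"

definition is_path :: "('v, 'e) bidirected_graph \<Rightarrow> 'v list \<Rightarrow> 'e list \<Rightarrow> bool" where
  "is_path G vs es \<longleftrightarrow> is_walk G vs es \<and> distinct es"

definition T_paths :: "('v, 'e) bidirected_graph \<Rightarrow> 'v set \<Rightarrow> ('v list \<times> 'e list) set" where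
  "T_paths G T = {(vs, es). is_path G vs es \<and>
     hd vs \<in> T \<and> last vs \<in> T \<and> hd vs \<noteq> last vs \<and>
     (\<forall>i \<in> {1..<length es}. vs ! i \<in> nodes G - T)}"

definition edge_disjoint :: "('v list \<times> 'e list) set \<Rightarrow> bool" where
  "edge_disjoint F \<longleftrightarrow> pairwise (\<lambda>p q. disjnt (set (snd p)) (set (snd q))) F"

definition max_T_paths :: "('v, 'e) bidirected_graph \<Rightarrow> 'v set \<Rightarrow> nat" where
  "max_T_paths G T = Max {card F | F. finite F \<and> F \<subseteq> T_paths G T \<and> edge_disjoint F}"

definition boundary :: "('v, 'e) bidirected_graph \<Rightarrow> 'v set \<Rightarrow> 'e set" where
  "boundary G X =
     {e \<in> edges G. \<exists>u v. ends G e = {#u, v#} \<and> u \<in> X \<and> v \<in> nodes G - X}"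

definition min_cut :: "('v, 'e) bidirected_graph \<Rightarrow> 'v set \<Rightarrow> 'v \<Rightarrow> nat" where
  "min_cut G T s = Min {card (boundary G X) | X. X \<subseteq> nodes G \<and> X \<inter> T = {s}}"

text \<open>The maximum and the minimum above range over finite nonempty sets.\<close>

lemma T_path_edges:
  assumes "p \<in> T_paths G T"
  shows "set (snd p) \<noteq> {}" "set (snd p) \<subseteq> edges G"
proof -
  obtain vs es where p: "p = (vs, es)" by (cases p)
  have "length vs = length es + 1" "hd vs \<noteq> last vs" "set es \<subseteq> edges G"
    using assms by (auto simp: p T_paths_def is_path_def is_walk_def)
  then show "set (snd p) \<noteq> {}" "set (snd p) \<subseteq> edges G"
    by (auto simp: p length_Suc_conv)
qed

lemma max_T_paths_wf:
  assumes "finite_bidirected_graph G"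
  shows "finite {card F | F. finite F \<and> F \<subseteq> T_paths G T \<and> edge_disjoint F}" (is "finite ?A")
    and "{card F | F. finite F \<and> F \<subseteq> T_paths G T \<and> edge_disjoint F} \<noteq> {}"
proof -
  have fin: "finite (edges G)"
    using assms by (simp add: finite_bidirected_graph_def)
  have "card F \<le> card (edges G)" if F: "F \<subseteq> T_paths G T" "edge_disjoint F" for F
  proof -
    have "inj_on (\<lambda>p. hd (snd p)) F"
    proof (rule inj_onI)
      fix p q assume pq: "p \<in> F" "q \<in> F" "hd (snd p) = hd (snd q)"
      have "hd (snd p) \<in> set (snd p)" "hd (snd q) \<in> set (snd q)"
        using T_path_edges(1) F(1) pq by (metis hd_in_set set_empty subsetD)+
      then have "\<not> disjnt (set (snd p)) (set (snd q))"
        using pq(3) by (auto simp: disjnt_def)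
      then show "p = q"
        using F(2) pq by (auto simp: edge_disjoint_def pairwise_def)
    qed
    moreover have "(\<lambda>p. hd (snd p)) ` F \<subseteq> edges G"
    proof (rule image_subsetI)
      fix p assume "p \<in> F"
      then have "p \<in> T_paths G T" using F(1) by blast
      then show "hd (snd p) \<in> edges G"
        using T_path_edges[of p G T] by (metis hd_in_set set_empty subsetD)
    qed
    ultimately show ?thesis using fin by (rule card_inj_on_le)
  qed
  then have "?A \<subseteq> {..card (edges G)}" by auto
  then show "finite ?A" by (rule finite_subset) simp
  show "?A \<noteq> {}" by (auto simp: edge_disjoint_def intro!: exI[of _ "{}"])
qed

lemma min_cut_wf:
  assumes "finite_bidirected_graph G" and "T \<subseteq> nodes G" and "s \<in> T"
  shows "finite {card (boundary G X) | X. X \<subseteq> nodes G \<and> X \<inter> T = {s}}"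
    and "{card (boundary G X) | X. X \<subseteq> nodes G \<and> X \<inter> T = {s}} \<noteq> {}"
proof -
  have "finite (Pow (nodes G))"
    using assms(1) by (simp add: finite_bidirected_graph_def)
  then have "finite {X. X \<subseteq> nodes G \<and> X \<inter> T = {s}}"
    by (rule rev_finite_subset) auto
  then show "finite {card (boundary G X) | X. X \<subseteq> nodes G \<and> X \<inter> T = {s}}"
    by simp
  show "{card (boundary G X) | X. X \<subseteq> nodes G \<and> X \<inter> T = {s}} \<noteq> {}"
    using assms by (auto intro!: exI[of _ "{s}"])
qed

end

theory Submission
  imports Defs
begin

text \<open>
  The inequality \<open>\<le>\<close> holds because a path between two terminals crosses a minimum cut of each
  of them.  For \<open>\<ge>\<close> we split off, at an inner node \<open>v\<close>, an edge \<open>e = uv\<close> together with an edge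
  \<open>f = vw\<close> of the opposite direction at \<open>v\<close>, replacing them by a single edge \<open>uw\<close>, without
  violating the bounds \<open>\<lambda>(s)\<close> on cuts; once all non-loop edges run between terminals, these edges
  are the required paths.  All cuts of a terminal have the same parity, so a splitting fails only
  if a tight set separates \<open>v\<close> from both \<open>u\<close> and \<open>w\<close>.  By uncrossing, the tight sets that
  separate \<open>u\<close> from \<open>v\<close> can be merged into one.  If every \<open>f\<close> failed, this one tight set would
  separate \<open>v\<close> from the far ends of \<open>e\<close> and of all the edges of the opposite direction, which is
  more than half of the degree of \<open>v\<close>; moving \<open>v\<close> across the cut would then make it too small.
\<close>

section \<open>Half-edges, cut sizes, degrees and walks\<close>

text \<open>
  Below, \<open>p e\<close> and \<open>q e\<close> are the two half-edges of \<open>e\<close>, in arbitrary order.  Unlike in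
  \<^const>\<open>finite_bidirected_graph\<close>, a loop may have two different directions, since
  splitting off can create such loops; a \<open>half_walk\<close> through a loop records in which direction
  it is traversed.
\<close>

definition joins :: "('e \<Rightarrow> 'h) \<Rightarrow> ('e \<Rightarrow> 'h) \<Rightarrow> 'e \<Rightarrow> 'h \<Rightarrow> 'h \<Rightarrow> bool" where
  "joins p q e a b \<longleftrightarrow> p e = a \<and> q e = b \<or> p e = b \<and> q e = a"

definition separates :: "'v set \<Rightarrow> 'v \<Rightarrow> 'v \<Rightarrow> bool" where
  "separates X u v \<longleftrightarrow> (u \<in> X) \<noteq> (v \<in> X)"

definition cut_size ::
    "('e \<Rightarrow> 'v \<times> 'd) \<Rightarrow> ('e \<Rightarrow> 'v \<times> 'd) \<Rightarrow> 'e set \<Rightarrow> 'v set \<Rightarrow> nat" where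
  "cut_size p q E X = (\<Sum>e\<in>E. of_bool (separates X (fst (p e)) (fst (q e))))"

text \<open>A loop whose two half-edges both equal \<open>a\<close> counts twice, as in
  \<open>deg_in\<close> and \<open>deg_out\<close>.\<close>

definition half_degree :: "('e \<Rightarrow> 'h) \<Rightarrow> ('e \<Rightarrow> 'h) \<Rightarrow> 'e set \<Rightarrow> 'h \<Rightarrow> nat" where
  "half_degree p q E a = (\<Sum>e\<in>E. of_bool (p e = a) + of_bool (q e = a))"

inductive half_walk ::
    "('e \<Rightarrow> 'v \<times> 'd) \<Rightarrow> ('e \<Rightarrow> 'v \<times> 'd) \<Rightarrow> 'v set \<Rightarrow> 'v \<times> 'd \<Rightarrow> 'e list \<Rightarrow> 'v \<times> 'd \<Rightarrow> bool"
  for p q T where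
  single: "joins p q e a b \<Longrightarrow> half_walk p q T a [e] b"
| step: "joins p q e a (v, d) \<Longrightarrow> v \<notin> T \<Longrightarrow> d \<noteq> d' \<Longrightarrow> half_walk p q T (v, d') es b \<Longrightarrow>
    half_walk p q T a (e # es) b"

text \<open>The paths are indexed rather than collected in a set, so that undoing a split can change
  the lists and keep their number \<open>card I\<close>.\<close>

definition packing ::
    "('e \<Rightarrow> 'v \<times> 'd) \<Rightarrow> ('e \<Rightarrow> 'v \<times> 'd) \<Rightarrow> 'v set \<Rightarrow> 'e set \<Rightarrow> 'i set \<Rightarrow> ('i \<Rightarrow> 'e list) \<Rightarrow> bool" where
  "packing p q T E I P \<longleftrightarrow>
     (\<forall>i\<in>I. distinct (P i) \<and> set (P i) \<subseteq> E \<and>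
        (\<exists>a b. half_walk p q T a (P i) b \<and> fst a \<in> T \<and> fst b \<in> T \<and> fst a \<noteq> fst b)) \<and>
     pairwise (\<lambda>i j. disjnt (set (P i)) (set (P j))) I"

section \<open>Undoing a split\<close>

text \<open>The new edge \<open>e\<close> is replaced by the old \<open>e\<close> followed by
  \<open>f\<close>, or by \<open>f\<close> followed by the old \<open>e\<close>, depending on the
  direction of traversal. Passing through \<open>v\<close> is legal because
  \<open>d \<noteq> d'\<close> and \<open>v\<close> is inner. The bound on \<open>set es'\<close>
  records that \<open>f\<close> enters only walks that used \<open>e\<close>.\<close>

lemma half_walk_unsplit:
  assumes "half_walk (p(e := a0)) (q(e := b0)) T a es b"
    and "joins p q e a0 (v, d)" "joins p q f (v, d') b0" "d \<noteq> d'" "v \<notin> T" "e \<noteq> f"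
    and "distinct es" "f \<notin> set es"
  shows "\<exists>es'. half_walk p q T a es' b \<and> distinct es' \<and>
           set es' \<subseteq> set es \<union> (if e \<in> set es then {f} else {})"
  using assms(1,7,8)
proof (induction rule: half_walk.induct)
  case (single e' a b)
  show ?case
  proof (cases "e' = e")
    case False
    then have "half_walk p q T a [e'] b"
      using single by (auto simp: joins_def intro!: half_walk.single)
    then show ?thesis using False by force
  next
    case True
    then consider "a = a0" "b = b0" | "a = b0" "b = a0"
      using single by (auto simp: joins_def)
    then show ?thesis
    proof cases
      case 1
      then have "half_walk p q T a [e, f] b"
        using assms(2-5) by (metis half_walk.intros)
      then show ?thesis using True assms(6) by (intro exI[of _ "[e, f]"]) auto
    next
      case 2
      then have "half_walk p q T a [f, e] b"
        using assms(2-5) by (metis half_walk.intros joins_def)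
      then show ?thesis using True assms(6) by (intro exI[of _ "[f, e]"]) auto
    qed
  qed
next
  case (step e' a w c c' es b)
  then obtain es' where es': "half_walk p q T (w, c') es' b" "distinct es'"
    "set es' \<subseteq> set es \<union> (if e \<in> set es then {f} else {})" by auto
  show ?case
  proof (cases "e' = e")
    case False
    then have "joins p q e' a (w, c)" using step.hyps(1) by (simp add: joins_def)
    then have "half_walk p q T a (e' # es') b"
      using step.hyps(2,3) es'(1) by (rule half_walk.step)
    moreover have "e' \<notin> set es'" using es'(3) step.prems by (auto split: if_splits)
    ultimately show ?thesis using False es' by (intro exI[of _ "e' # es'"]) auto
  next
    case True
    then have e: "set es' \<subseteq> set es" "e \<notin> set es'" "f \<notin> set es'"
      using es'(3) step.prems by auto
    consider "a = a0" "(w, c) = b0" | "a = b0" "(w, c) = a0"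
      using True step by (auto simp: joins_def)
    then show ?thesis
    proof cases
      case 1
      then have "half_walk p q T a (e # f # es') b"
        using assms(2-5) step.hyps es'(1) by (metis half_walk.step)
      then show ?thesis using True assms(6) e es' by (intro exI[of _ "e # f # es'"]) auto
    next
      case 2
      have *: "joins p q f a (v, d')" "joins p q e (v, d) (w, c)"
        using 2 assms(2,3) by (auto simp: joins_def)
      have "half_walk p q T a (f # e # es') b"
        using half_walk.step[OF *(1) assms(5) assms(4)[symmetric]
            half_walk.step[OF *(2) step.hyps(2,3) es'(1)]] .
      then show ?thesis using True assms(6) e es' by (intro exI[of _ "f # e # es'"]) auto
    qed
  qed
qed

text \<open>At most one path of the packing contains \<open>e\<close>, so at most one takes up
  \<open>f\<close>, which no path used before. Hence disjointness survives.\<close>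

lemma packing_unsplit:
  assumes "packing (p(e := a0)) (q(e := b0)) T (E - {f}) I P"
    and "joins p q e a0 (v, d)" "joins p q f (v, d') b0" "d \<noteq> d'" "v \<notin> T" "e \<noteq> f" "f \<in> E"
  shows "\<exists>P'. packing p q T E I P'"
proof -
  have "\<exists>es'. (\<exists>a b. half_walk p q T a es' b \<and> fst a \<in> T \<and> fst b \<in> T \<and> fst a \<noteq> fst b) \<and>
      distinct es' \<and> set es' \<subseteq> set (P i) \<union> (if e \<in> set (P i) then {f} else {})"
    if i: "i \<in> I" for i
  proof -
    obtain a b where "half_walk (p(e := a0)) (q(e := b0)) T a (P i) b"
      and ab: "fst a \<in> T" "fst b \<in> T" "fst a \<noteq> fst b"
      and P: "distinct (P i)" "set (P i) \<subseteq> E - {f}"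
      using assms(1) i unfolding packing_def by blast
    from half_walk_unsplit[OF this(1) assms(2-6)] P ab show ?thesis by blast
  qed
  then obtain P' where P': "\<And>i. i \<in> I \<Longrightarrow>
      (\<exists>a b. half_walk p q T a (P' i) b \<and> fst a \<in> T \<and> fst b \<in> T \<and> fst a \<noteq> fst b) \<and>
      distinct (P' i) \<and> set (P' i) \<subseteq> set (P i) \<union> (if e \<in> set (P i) then {f} else {})"
    by metis
  have sub: "set (P i) \<subseteq> E - {f}" if "i \<in> I" for i
    using assms(1) that by (auto simp: packing_def)
  have "disjnt (set (P' i)) (set (P' j))" if "i \<in> I" "j \<in> I" "i \<noteq> j" for i j
  proof -
    have "disjnt (set (P i)) (set (P j))"
      using assms(1) that by (auto simp: packing_def pairwise_def)
    moreover have "set (P' i) \<subseteq> set (P i) \<union> (if e \<in> set (P i) then {f} else {})"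
      "set (P' j) \<subseteq> set (P j) \<union> (if e \<in> set (P j) then {f} else {})"
      using P' that by blast+
    ultimately show ?thesis using sub[OF that(1)] sub[OF that(2)]
      unfolding disjnt_def by (cases "e \<in> set (P i)"; cases "e \<in> set (P j)"; simp) blast+
  qed
  moreover have "set (P' i) \<subseteq> E" if "i \<in> I" for i
    using P'[OF that] sub[OF that] assms(7) by (auto split: if_splits)
  ultimately have "packing p q T E I P'"
    using P' by (auto simp: packing_def pairwise_def)
  then show ?thesis by blast
qed

section \<open>Effect of a split on cuts and degrees\<close>

lemma cut_size_insert:
  assumes "finite E" "e \<notin> E"
  shows "cut_size p q (insert e E) X = of_bool (separates X (fst (p e)) (fst (q e))) + cut_size p q E X"
  unfolding cut_size_def using assms by (rule sum.insert)

lemma half_degree_insert: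
  assumes "finite E" "e \<notin> E"
  shows "half_degree p q (insert e E) a = of_bool (p e = a) + of_bool (q e = a) + half_degree p q E a"
  unfolding half_degree_def using assms by (rule sum.insert)

lemma cut_size_fun_upd:
  "e \<notin> E \<Longrightarrow> cut_size (p(e := a)) (q(e := b)) E X = cut_size p q E X"
  unfolding cut_size_def by (intro sum.cong) auto

lemma half_degree_fun_upd:
  "e \<notin> E \<Longrightarrow> half_degree (p(e := a)) (q(e := b)) E x = half_degree p q E x"
  unfolding half_degree_def by (intro sum.cong) auto

text \<open>The route from \<open>u\<close> via \<open>v\<close> to \<open>w\<close> crosses a cut
  as often as a direct edge does, except that it crosses twice instead of never when
  \<open>v\<close> is separated from both ends. So a split never enlarges a cut and keeps its
  parity.\<close>

lemma cut_size_split: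
  assumes "finite E" "e \<in> E" "f \<in> E" "e \<noteq> f"
    and "joins p q e (u, c) (v, d)" "joins p q f (v, d') (w, c')"
  shows "cut_size p q E X = cut_size (p(e := (u, c))) (q(e := (w, c'))) (E - {f}) X
           + (if separates X u v \<and> separates X w v then 2 else 0)"
proof -
  define R where "R = E - {e, f}"
  have R: "finite R" "e \<notin> R" "f \<notin> R" "E = insert e (insert f R)" "E - {f} = insert e R"
    using assms(1-4) by (auto simp: R_def)
  have "separates X (fst (p e)) (fst (q e)) = separates X u v"
    "separates X (fst (p f)) (fst (q f)) = separates X v w"
    using assms(5,6) by (auto simp: joins_def separates_def)
  then have "cut_size p q E X =
      of_bool (separates X u v) + of_bool (separates X v w) + cut_size p q R X"
    using R(1-3) assms(4) by (simp add: R(4) cut_size_insert)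
  moreover have "cut_size (p(e := (u, c))) (q(e := (w, c'))) (E - {f}) X =
      of_bool (separates X u w) + cut_size p q R X"
    using R(1-3) by (simp add: R(5) cut_size_insert cut_size_fun_upd)
  ultimately show ?thesis by (auto simp: separates_def)
qed

text \<open>For \<open>d \<noteq> d'\<close> exactly one half-edge of each direction disappears at
  \<open>v\<close>, which keeps inner nodes balanced.\<close>

lemma half_degree_split:
  assumes "finite E" "e \<in> E" "f \<in> E" "e \<noteq> f"
    and "joins p q e a (v, d)" "joins p q f (v, d') b"
  shows "half_degree p q E x = half_degree (p(e := a)) (q(e := b)) (E - {f}) x
           + of_bool (x = (v, d)) + of_bool (x = (v, d'))"
proof -
  define R where "R = E - {e, f}"
  have R: "finite R" "e \<notin> R" "f \<notin> R" "E = insert e (insert f R)" "E - {f} = insert e R"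
    using assms(1-4) by (auto simp: R_def)
  have "of_bool (p e = x) + of_bool (q e = x) = of_bool (a = x) + (of_bool (x = (v, d)) :: nat)"
    "of_bool (p f = x) + of_bool (q f = x) = of_bool (x = (v, d')) + (of_bool (b = x) :: nat)"
    using assms(5,6) by (auto simp: joins_def)
  then have "half_degree p q E x = of_bool (a = x) + of_bool (x = (v, d)) +
      (of_bool (x = (v, d')) + of_bool (b = x)) + half_degree p q R x"
    using R(1-3) assms(4) by (simp add: R(4) half_degree_insert)
  moreover have "half_degree (p(e := a)) (q(e := b)) (E - {f}) x =
      of_bool (a = x) + of_bool (b = x) + half_degree p q R x"
    using R(1-3) by (simp add: R(5) half_degree_insert half_degree_fun_upd)
  ultimately show ?thesis by simp
qed

section \<open>Uncrossing tight sets\<close>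

text \<open>Submodularity, which holds edge by edge.\<close>

lemma cut_size_Un_Int:
  assumes "finite E"
  shows "cut_size p q E (X \<union> Y) + cut_size p q E (X \<inter> Y) \<le> cut_size p q E X + cut_size p q E Y"
  unfolding cut_size_def sum.distrib[symmetric]
  by (rule sum_mono) (auto simp: separates_def)

text \<open>An edge between \<open>X - Y\<close> and \<open>Y - X\<close> counts twice on the right
  and not at all on the left.\<close>

lemma cut_size_Un_Int_strict:
  assumes "finite E" "e \<in> E" "joins p q e a b" "fst a \<in> X - Y" "fst b \<in> Y - X"
  shows "cut_size p q E (X \<union> Y) + cut_size p q E (X \<inter> Y) < cut_size p q E X + cut_size p q E Y"
  unfolding cut_size_def sum.distrib[symmetric]
proof (rule sum_strict_mono_ex1)
  show "\<exists>e\<in>E. of_bool (separates (X \<union> Y) (fst (p e)) (fst (q e)))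
      + of_bool (separates (X \<inter> Y) (fst (p e)) (fst (q e)))
    < of_bool (separates X (fst (p e)) (fst (q e))) + (of_bool (separates Y (fst (p e)) (fst (q e))) :: nat)"
    using assms by (intro bexI[of _ e]) (auto simp: separates_def joins_def)
qed (use assms in \<open>auto simp: separates_def\<close>)

text \<open>This is submodularity for \<open>X\<close> and the complement of \<open>Y\<close>, as a
  set and its complement have the same cut.\<close>

lemma cut_size_Diff_Diff:
  assumes "finite E"
  shows "cut_size p q E (X - Y) + cut_size p q E (Y - X) \<le> cut_size p q E X + cut_size p q E Y"
  unfolding cut_size_def sum.distrib[symmetric]
  by (rule sum_mono) (auto simp: separates_def)

text \<open>An edge from \<open>X \<inter> Y\<close> to the outside of \<open>X \<union> Y\<close>
  counts twice on the right and not at all on the left.\<close>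

lemma cut_size_Diff_Diff_strict:
  assumes "finite E" "e \<in> E" "joins p q e a b" "fst a \<in> X \<inter> Y" "fst b \<notin> X \<union> Y"
  shows "cut_size p q E (X - Y) + cut_size p q E (Y - X) < cut_size p q E X + cut_size p q E Y"
  unfolding cut_size_def sum.distrib[symmetric]
proof (rule sum_strict_mono_ex1)
  show "\<exists>e\<in>E. of_bool (separates (X - Y) (fst (p e)) (fst (q e)))
      + of_bool (separates (Y - X) (fst (p e)) (fst (q e)))
    < of_bool (separates X (fst (p e)) (fst (q e))) + (of_bool (separates Y (fst (p e)) (fst (q e))) :: nat)"
    using assms by (intro bexI[of _ e]) (auto simp: separates_def joins_def)
qed (use assms in \<open>auto simp: separates_def\<close>)

text \<open>The bound \<open>l\<close> is a parameter, not the current minimum cut: it keeps the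
  original values while edges are split off.\<close>

definition tight_sets ::
    "('e \<Rightarrow> 'v \<times> 'd) \<Rightarrow> ('e \<Rightarrow> 'v \<times> 'd) \<Rightarrow> 'v set \<Rightarrow> ('v \<Rightarrow> nat) \<Rightarrow> 'e set \<Rightarrow> 'v set set" where
  "tight_sets p q T l E = {X. \<exists>s. X \<inter> T = {s} \<and> cut_size p q E X = l s}"

text \<open>Tight sets of the same terminal uncross by \<open>\<union>\<close> and \<open>\<inter>\<close>, those of different terminals by
  the two differences; \<open>e\<close> excludes the cases in which no uncrossed set would separate \<open>u\<close> from
  \<open>v\<close>.\<close>

lemma tight_sets_merge:
  assumes fin: "finite E"
    and lower: "\<And>X s. X \<inter> T = {s} \<Longrightarrow> l s \<le> cut_size p q E X"
    and e: "e \<in> E" "joins p q e (u, c) (v, d)"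
    and X: "X \<in> tight_sets p q T l E" "separates X u v"
    and Y: "Y \<in> tight_sets p q T l E" "separates Y u v"
  shows "\<exists>Z \<in> tight_sets p q T l E. separates Z u v \<and>
           (\<forall>w. separates X w v \<or> separates Y w v \<longrightarrow> separates Z w v)"
proof -
  have e': "joins p q e (v, d) (u, c)" using e(2) by (auto simp: joins_def)
  obtain s t where s: "X \<inter> T = {s}" "cut_size p q E X = l s"
    and t: "Y \<inter> T = {t}" "cut_size p q E Y = l t"
    using X Y by (auto simp: tight_sets_def)
  show ?thesis
  proof (cases "s = t")
    case True
    have "(X \<union> Y) \<inter> T = {s}" "(X \<inter> Y) \<inter> T = {s}" using s t True by auto
    note Un = this(1) lower[OF this(1)] and Int = this(2) lower[OF this(2)]
    have no: "\<not> (u \<in> X - Y \<and> v \<in> Y - X)" "\<not> (v \<in> X - Y \<and> u \<in> Y - X)"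
      using cut_size_Un_Int_strict[OF fin e, of X Y] cut_size_Un_Int_strict[OF fin e(1) e', of X Y]
        Un(2) Int(2) s(2) t(2) True by auto
    \<comment> \<open>Both cuts are at least \<open>l s\<close> and their sum is at most
      \<open>2 * l s\<close>, so both attain the bound.\<close>
    have "cut_size p q E (X \<union> Y) = l s" "cut_size p q E (X \<inter> Y) = l s"
      using cut_size_Un_Int[OF fin, of p q X Y] Un(2) Int(2) s(2) t(2) True by auto
    then have tight: "X \<union> Y \<in> tight_sets p q T l E" "X \<inter> Y \<in> tight_sets p q T l E"
      using Un(1) Int(1) by (auto simp: tight_sets_def)
    \<comment> \<open>By \<open>no\<close>, the node \<open>v\<close> lies in both sets or in
      neither, with \<open>u\<close> on the opposite side. The intersection serves in the first
      case, the union in the second.\<close>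
    show ?thesis
    proof (cases "v \<in> X")
      case True
      then show ?thesis using no X Y
        by (intro bexI[OF _ tight(2)]) (auto simp: separates_def)
    next
      case False
      then show ?thesis using no X Y
        by (intro bexI[OF _ tight(1)]) (auto simp: separates_def)
    qed
  next
    case False
    have "(X - Y) \<inter> T = {s}" "(Y - X) \<inter> T = {t}" using s t False by auto
    note XY = this(1) lower[OF this(1)] and YX = this(2) lower[OF this(2)]
    have no: "\<not> (u \<in> X \<inter> Y \<and> v \<notin> X \<union> Y)" "\<not> (v \<in> X \<inter> Y \<and> u \<notin> X \<union> Y)"
      using cut_size_Diff_Diff_strict[OF fin e, of X Y]
        cut_size_Diff_Diff_strict[OF fin e(1) e', of X Y] XY(2) YX(2) s(2) t(2) by auto
    have "cut_size p q E (X - Y) = l s" "cut_size p q E (Y - X) = l t"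
      using cut_size_Diff_Diff[OF fin, of p q X Y] XY(2) YX(2) s(2) t(2) by auto
    then have tight: "X - Y \<in> tight_sets p q T l E" "Y - X \<in> tight_sets p q T l E"
      using XY(1) YX(1) by (auto simp: tight_sets_def)
    \<comment> \<open>Now \<open>no\<close> forces exactly one of \<open>X\<close> and
      \<open>Y\<close> to contain \<open>v\<close>, and the other to contain \<open>u\<close>. The
      difference that contains \<open>v\<close> serves.\<close>
    show ?thesis
    proof (cases "v \<in> X")
      case True
      then show ?thesis using no X Y
        by (intro bexI[OF _ tight(1)]) (auto simp: separates_def)
    next
      case False
      then show ?thesis using no X Y
        by (intro bexI[OF _ tight(2)]) (auto simp: separates_def)
    qed
  qed
qed

text \<open>Merging keeps every node that either set separates from \<open>v\<close>, so one tight
  set can be accumulated over all of \<open>S\<close>.\<close>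

lemma tight_sets_merge_finite:
  assumes "finite E"
    and "\<And>X s. X \<inter> T = {s} \<Longrightarrow> l s \<le> cut_size p q E X"
    and "e \<in> E" "joins p q e (u, c) (v, d)"
    and "finite S" "S \<noteq> {}"
    and "\<And>w. w \<in> S \<Longrightarrow> \<exists>X \<in> tight_sets p q T l E. separates X u v \<and> separates X w v"
  shows "\<exists>Z \<in> tight_sets p q T l E. separates Z u v \<and> (\<forall>w\<in>S. separates Z w v)"
  using assms(5-7)
proof (induction S rule: finite_ne_induct)
  case (singleton w)
  then show ?case by auto
next
  case (insert w S)
  then obtain Y where Y: "Y \<in> tight_sets p q T l E" "separates Y u v" "\<forall>w\<in>S. separates Y w v"
    by blast
  obtain X where X: "X \<in> tight_sets p q T l E" "separates X u v" "separates X w v"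
    using insert.prems by blast
  show ?case using tight_sets_merge[OF assms(1-4) X(1,2) Y(1,2)] X(3) Y(3) by auto
qed

section \<open>Existence of an admissible split\<close>

text \<open>The condition on tight sets is what keeps the bounds valid: by
  \<open>cut_size_split\<close> only cuts separating \<open>v\<close> from both \<open>u\<close> and
  \<open>w\<close> shrink.\<close>

lemma exists_admissible_split:
  fixes p q :: "'e \<Rightarrow> 'v \<times> direction"
  assumes fin: "finite E"
    and lower: "\<And>X s. X \<inter> T = {s} \<Longrightarrow> l s \<le> cut_size p q E X"
    and v: "v \<notin> T" "\<And>d d'. half_degree p q E (v, d) = half_degree p q E (v, d')"
    and e: "e \<in> E" "joins p q e (u, c) (v, d)" "u \<noteq> v"
  shows "\<exists>f\<in>E. \<exists>d' w c'. e \<noteq> f \<and> d \<noteq> d' \<and> joins p q f (v, d') (w, c') \<and>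
           (\<forall>X \<in> tight_sets p q T l E. \<not> (separates X u v \<and> separates X w v))"
proof (rule ccontr)
  assume none: "\<not> ?thesis"
  obtain d' where d': "d \<noteq> d'" by (metis direction.distinct(1))
  \<comment> \<open>The far ends of all possible partners of \<open>e\<close>. A loop at
    \<open>v\<close> with a half-edge \<open>(v, d')\<close> puts \<open>v\<close> itself into
    \<open>S\<close>; then \<open>bad\<close> already yields a contradiction, as no set separates
    \<open>v\<close> from itself.\<close>
  define S where "S = {w. \<exists>f\<in>E. \<exists>c'. joins p q f (v, d') (w, c')}"
  have bad: "\<exists>X \<in> tight_sets p q T l E. separates X u v \<and> separates X w v" if "w \<in> S" for w
  proof -
    from that obtain f c' where f: "f \<in> E" "joins p q f (v, d') (w, c')" by (auto simp: S_def)
    have "e \<noteq> f" using f(2) e(2,3) d' by (auto simp: joins_def)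
    then show ?thesis using none f d' by blast
  qed
  have "S \<subseteq> fst ` p ` E \<union> fst ` q ` E"
    by (force simp: S_def joins_def)
  then have "finite S" using fin by (meson finite_UnI finite_imageI finite_subset)
  \<comment> \<open>The half-edge of \<open>e\<close> at \<open>v\<close> and the balance at
    \<open>v\<close> provide a partner, so \<open>S\<close> is not empty.\<close>
  have "half_degree p q E (v, d) \<noteq> 0"
    using fin e(1,2) by (auto simp: half_degree_def joins_def)
  then have "half_degree p q E (v, d') \<noteq> 0" using v(2) by metis
  then obtain f where f: "f \<in> E" "p f = (v, d') \<or> q f = (v, d')"
    using fin by (auto simp: half_degree_def)
  then have "joins p q f (v, d') (p f) \<or> joins p q f (v, d') (q f)" by (auto simp: joins_def)
  then obtain w c' where "joins p q f (v, d') (w, c')" by (metis surj_pair)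
  then have "S \<noteq> {}" using f(1) by (auto simp: S_def)
  obtain Z where Z: "Z \<in> tight_sets p q T l E" "separates Z u v" "\<forall>w\<in>S. separates Z w v"
    using tight_sets_merge_finite[OF fin lower e(1,2) \<open>finite S\<close> \<open>S \<noteq> {}\<close> bad] by blast
  then obtain s where s: "Z \<inter> T = {s}" "cut_size p q E Z = l s"
    by (auto simp: tight_sets_def)
  define Z' where "Z' = (if v \<in> Z then Z - {v} else insert v Z)"
  have Z'_iff: "x \<in> Z' \<longleftrightarrow> (if x = v then v \<notin> Z else x \<in> Z)" for x
    by (auto simp: Z'_def)
  have "Z' \<inter> T = {s}" using s(1) v(1) by (auto simp: Z'_def)
  \<comment> \<open>Moving \<open>v\<close> across a tight cut cannot shrink it, so at most half of the half-edges at \<open>v\<close>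
    lead to the far side of \<open>Z\<close>; but all those of direction \<open>d'\<close> do, and so does \<open>e\<close>.\<close>
  have "cut_size p q E Z' + half_degree p q E (v, d') < cut_size p q E Z + half_degree p q E (v, d)"
    unfolding cut_size_def half_degree_def sum.distrib[symmetric]
  proof (rule sum_strict_mono_ex1)
    have far: "separates Z w v" if "g \<in> E" "joins p q g (v, d') (w, c')" for g w c'
      using Z(3) that by (auto simp: S_def)
    show "\<forall>x\<in>E. of_bool (separates Z' (fst (p x)) (fst (q x)))
          + (of_bool (p x = (v, d')) + of_bool (q x = (v, d')))
        \<le> of_bool (separates Z (fst (p x)) (fst (q x)))
          + (of_bool (p x = (v, d)) + (of_bool (q x = (v, d)) :: nat))"
    proof
      fix x assume x: "x \<in> E"
      obtain y1 d1 y2 d2 where pq: "p x = (y1, d1)" "q x = (y2, d2)" by (metis surj_pair)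
      have dd: "d1 = d \<or> d1 = d'" "d2 = d \<or> d2 = d'"
        using d' by (metis direction.exhaust)+
      have far2: "separates Z y2 v" if "y1 = v" "d1 = d'" using far[OF x, of y2 d2] pq that by (auto simp: joins_def)
      have far1: "separates Z y1 v" if "y2 = v" "d2 = d'" using far[OF x, of y1 d1] pq that by (auto simp: joins_def)
      \<comment> \<open>Moving \<open>v\<close> changes whether an edge is cut exactly when one of
        its two ends is \<open>v\<close> and the other is not.\<close>
      have "separates Z' y1 y2 \<longleftrightarrow> separates Z y1 y2 = ((y1 = v) = (y2 = v))"
        "separates Z v v \<longleftrightarrow> False" "separates Z v y2 \<longleftrightarrow> separates Z y2 v"
        by (auto simp: separates_def Z'_iff)
      then show "of_bool (separates Z' (fst (p x)) (fst (q x)))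
          + (of_bool (p x = (v, d')) + of_bool (q x = (v, d')))
        \<le> of_bool (separates Z (fst (p x)) (fst (q x)))
          + (of_bool (p x = (v, d)) + (of_bool (q x = (v, d)) :: nat))"
        unfolding pq fst_conv using dd far1 far2 d'
        by (cases "y1 = v"; cases "y2 = v"; elim disjE; simp)
    qed
    \<comment> \<open>At \<open>e\<close> the left side is 0 and the right side is 2:
      \<open>e\<close> crosses \<open>Z\<close> but not \<open>Z'\<close>, and its only half-edge at
      \<open>v\<close> has direction \<open>d\<close>.\<close>
    show "\<exists>x\<in>E. of_bool (separates Z' (fst (p x)) (fst (q x)))
          + (of_bool (p x = (v, d')) + of_bool (q x = (v, d')))
        < of_bool (separates Z (fst (p x)) (fst (q x)))
          + (of_bool (p x = (v, d)) + (of_bool (q x = (v, d)) :: nat))"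
      using e d' Z(2) by (intro bexI[of _ e]) (auto simp: joins_def separates_def Z'_iff)
  qed (rule fin)
  then show False using v(2)[of d d'] lower[OF \<open>Z' \<inter> T = {s}\<close>] s(2) by linarith
qed

section \<open>Packing by induction on the number of edges\<close>

text \<open>Every edge that is not a loop is a path by itself and lies in just two singleton cuts,
  those of its ends. These edges also index the paths.\<close>

lemma exists_packing_without_inner_nodes:
  assumes "finite E" "finite T"
    and lower: "\<And>s. s \<in> T \<Longrightarrow> l s \<le> cut_size p q E {s}"
    and terminal: "\<And>e. e \<in> E \<Longrightarrow> fst (p e) \<noteq> fst (q e) \<Longrightarrow> fst (p e) \<in> T \<and> fst (q e) \<in> T"
  shows "\<exists>I\<subseteq>E. \<exists>P. packing p q T E I P \<and> (\<Sum>s\<in>T. l s) \<le> 2 * card I"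
proof -
  define I where "I = {e\<in>E. fst (p e) \<noteq> fst (q e)}"
  have "half_walk p q T (p e) [e] (q e)" for e
    by (rule half_walk.single) (simp add: joins_def)
  then have "packing p q T E I (\<lambda>e. [e])"
    using terminal unfolding packing_def by (fastforce simp: I_def pairwise_def)
  moreover have "(\<Sum>s\<in>T. l s) \<le> 2 * card I"
  proof -
    have "(\<Sum>s\<in>T. l s) \<le> (\<Sum>s\<in>T. cut_size p q E {s})"
      by (intro sum_mono lower)
    also have "\<dots> = (\<Sum>e\<in>E. \<Sum>s\<in>T. of_bool (separates {s} (fst (p e)) (fst (q e))))"
      unfolding cut_size_def by (rule sum.swap)
    also have "\<dots> \<le> (\<Sum>e\<in>E. 2 * of_bool (e \<in> I))"
    proof (rule sum_mono)
      fix e assume "e \<in> E"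
      have "(\<Sum>s\<in>T. of_bool (separates {s} (fst (p e)) (fst (q e)))) \<le>
          (\<Sum>s\<in>T. (of_bool (s = fst (p e)) + of_bool (s = fst (q e))) * (of_bool (e \<in> I) :: nat))"
        using \<open>e \<in> E\<close> by (intro sum_mono) (auto simp: separates_def I_def)
      also have "\<dots> \<le> 2 * of_bool (e \<in> I)"
        using assms(2) by (auto simp: sum.distrib of_bool_def)
      finally show "(\<Sum>s\<in>T. of_bool (separates {s} (fst (p e)) (fst (q e)))) \<le> (2 * of_bool (e \<in> I) :: nat)" .
    qed
    also have "\<dots> = 2 * card I"
      using assms(1) by (simp add: sum_distrib_left[symmetric] I_def Int_def)
    finally show ?thesis .
  qed
  moreover have "I \<subseteq> E" by (auto simp: I_def)
  ultimately show ?thesis by blast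
qed

text \<open>A split removes one edge and preserves the hypotheses on bounds, parity and balance,
  with \<open>l\<close> and \<open>T\<close> fixed. Parity is carried along because it makes every
  cut that is not tight exceed its bound by at least 2, which absorbs the loss in a split.\<close>

lemma exists_packing:
  fixes p q :: "'e \<Rightarrow> 'v \<times> direction"
  assumes "finite E" "finite T"
    and "\<And>X s. X \<inter> T = {s} \<Longrightarrow> l s \<le> cut_size p q E X"
    and "\<And>X s. X \<inter> T = {s} \<Longrightarrow> even (cut_size p q E X + l s)"
    and "\<And>v d d'. v \<notin> T \<Longrightarrow> half_degree p q E (v, d) = half_degree p q E (v, d')"
  shows "\<exists>I\<subseteq>E. \<exists>P. packing p q T E I P \<and> (\<Sum>s\<in>T. l s) \<le> 2 * card I"
  using assms
proof (induction "card E" arbitrary: E p q rule: less_induct)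
  case less
  note fin = less.prems(1) and lower = less.prems(3) and parity = less.prems(4)
    and balanced = less.prems(5)
  show ?case
  proof (cases "\<exists>e\<in>E. \<exists>u c v d. joins p q e (u, c) (v, d) \<and> u \<noteq> v \<and> v \<notin> T")
    case True
    then obtain e u c v d where e: "e \<in> E" "joins p q e (u, c) (v, d)" "u \<noteq> v" and v: "v \<notin> T"
      by blast
    obtain f d' w c' where f: "f \<in> E" "e \<noteq> f" "d \<noteq> d'" "joins p q f (v, d') (w, c')"
      and good: "\<And>X. X \<in> tight_sets p q T l E \<Longrightarrow> \<not> (separates X u v \<and> separates X w v)"
      using exists_admissible_split[where l = l, OF fin lower v balanced[OF v] e] by blast
    let ?p = "p(e := (u, c))" and ?q = "q(e := (w, c'))" and ?E = "E - {f}"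
    note cut = cut_size_split[OF fin e(1) f(1,2) e(2) f(4)]
    have "\<exists>I\<subseteq>?E. \<exists>P. packing ?p ?q T ?E I P \<and> (\<Sum>s\<in>T. l s) \<le> 2 * card I"
    proof (rule less.hyps)
      show "card ?E < card E" using fin f(1) by (meson card_Diff1_less)
      show "l s \<le> cut_size ?p ?q ?E X" if X: "X \<inter> T = {s}" for X s
      proof (cases "cut_size p q E X = l s")
        case True
        then have "\<not> (separates X u v \<and> separates X w v)"
          using good X by (auto simp: tight_sets_def)
        then show ?thesis using cut[of X] True by simp
      next
        case False
        then have "l s + 2 \<le> cut_size p q E X"
          using lower[OF X] parity[OF X]
          by (metis add_2_eq_Suc' add_Suc_right even_Suc le_antisym not_less_eq_eq add.commute even_add)
        then show ?thesis using cut[of X] by (simp split: if_splits)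
      qed
      show "even (cut_size ?p ?q ?E X + l s)" if "X \<inter> T = {s}" for X s
        using parity[OF that] cut[of X] by (simp split: if_splits)
      show "half_degree ?p ?q ?E (x, k) = half_degree ?p ?q ?E (x, k')" if "x \<notin> T" for x k k'
      proof -
        have "k = d \<or> k = d'" "k' = d \<or> k' = d'" using f(3) by (metis direction.exhaust)+
        then show ?thesis
          using half_degree_split[OF fin e(1) f(1,2) e(2) f(4), of "(x, k)"]
            half_degree_split[OF fin e(1) f(1,2) e(2) f(4), of "(x, k')"]
            balanced[OF that, of k k'] f(3) by auto
      qed
    qed (use fin less.prems(2) in auto)
    then obtain I P where I: "I \<subseteq> ?E" "packing ?p ?q T ?E I P" "(\<Sum>s\<in>T. l s) \<le> 2 * card I"
      by blast
    obtain P' where "packing p q T E I P'"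
      using packing_unsplit[OF I(2) e(2) f(4,3) v f(2,1)] by blast
    then show ?thesis using I by blast
  next
    case False
    show ?thesis
    proof (rule exists_packing_without_inner_nodes[OF fin less.prems(2)])
      show "l s \<le> cut_size p q E {s}" if "s \<in> T" for s
        using that by (intro lower) auto
      show "fst (p e) \<in> T \<and> fst (q e) \<in> T" if "e \<in> E" "fst (p e) \<noteq> fst (q e)" for e
        using False that unfolding joins_def by (metis prod.collapse)
    qed
  qed
qed

section \<open>Parity of cuts\<close>

text \<open>A handshake argument: inner nodes of \<open>X\<close> have even total degree, so the
  parity of the cut depends on the degree of \<open>s\<close> only. In particular all cuts of
  \<open>s\<close> have the same parity.\<close>

lemma even_cut_size:
  fixes p q :: "'e \<Rightarrow> 'v \<times> direction"
  assumes "finite E"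
    and "\<And>v d d'. v \<notin> T \<Longrightarrow> half_degree p q E (v, d) = half_degree p q E (v, d')"
    and X: "X \<inter> T = {s}"
  shows "even (cut_size p q E X + half_degree p q E (s, Entering) + half_degree p q E (s, Leaving))"
proof -
  let ?h = "half_degree p q E"
  \<comment> \<open>\<open>X\<close> may be infinite, so the sum runs over its nodes that meet an
    edge; \<open>s\<close> is added so that it can be split off the sum.\<close>
  define N where "N = X \<inter> (fst ` p ` E \<union> fst ` q ` E \<union> {s})"
  have N: "finite N" using assms(1) by (auto simp: N_def)
  have "?h (x, Entering) + ?h (x, Leaving) =
      (\<Sum>e\<in>E. of_bool (fst (p e) = x) + of_bool (fst (q e) = x))" for x
    unfolding half_degree_def sum.distrib[symmetric]
    by (intro sum.cong refl) (auto simp: prod_eq_iff, (metis direction.exhaust)+)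
  then have "(\<Sum>x\<in>N. ?h (x, Entering) + ?h (x, Leaving)) =
      (\<Sum>e\<in>E. \<Sum>x\<in>N. of_bool (fst (p e) = x) + of_bool (fst (q e) = x))"
    by (simp add: sum.swap[of _ E])
  also have "\<dots> = (\<Sum>e\<in>E. of_bool (fst (p e) \<in> X) + of_bool (fst (q e) \<in> X))"
    using N by (intro sum.cong) (auto simp: sum.distrib of_bool_def N_def)
  \<comment> \<open>For each edge, the cut indicator plus the number of ends in \<open>X\<close> is
    0 or 2.\<close>
  finally have "even (cut_size p q E X + (\<Sum>x\<in>N. ?h (x, Entering) + ?h (x, Leaving)))"
    unfolding cut_size_def
    by (simp add: sum.distrib[symmetric]) (auto intro!: dvd_sum simp: separates_def)
  moreover have "(\<Sum>x\<in>N. ?h (x, Entering) + ?h (x, Leaving)) =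
      ?h (s, Entering) + ?h (s, Leaving) + (\<Sum>x\<in>N - {s}. ?h (x, Entering) + ?h (x, Leaving))"
    using N X by (intro sum.remove) (auto simp: N_def)
  moreover have "even (\<Sum>x\<in>N - {s}. ?h (x, Entering) + ?h (x, Leaving))"
  proof (rule dvd_sum)
    fix x assume "x \<in> N - {s}"
    then have "x \<notin> T" using X by (auto simp: N_def)
    then show "even (?h (x, Entering) + ?h (x, Leaving))"
      using assms(2)[of x Entering Leaving] by simp
  qed
  ultimately show ?thesis by (simp add: add.assoc)
qed

section \<open>From half-edge walks to walks in the graph\<close>

lemma is_walk_iff:
  "is_walk G vs es \<longleftrightarrow>
     length vs = length es + 1 \<and> set vs \<subseteq> nodes G \<and> set es \<subseteq> edges G \<and>
     (\<forall>i<length es. ends G (es ! i) = {#vs ! i, vs ! Suc i#}) \<and>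
     (\<forall>i. Suc i < length es \<longrightarrow> transit_pair G (vs ! Suc i) (es ! i) (es ! Suc i))"
proof -
  have "{1..n} = Suc ` {i. i < n}" "{1..<n} = Suc ` {i. Suc i < n}" for n
    by (auto simp: image_iff Suc_le_eq dest!: gr0_implies_Suc)
  then show ?thesis by (simp add: is_walk_def)
qed

text \<open>The last conjunct serves the induction: the half-edge with which the walk starts is
  needed for the transit pair when another edge is put in front.\<close>

lemma half_walk_imp_walk:
  assumes "half_walk p q T a es b" "set es \<subseteq> edges G"
    and "finite_bidirected_graph G"
    and pq: "\<And>e. e \<in> edges G \<Longrightarrow> halves G e = {#p e, q e#}"
  shows "\<exists>vs. is_walk G vs es \<and> hd vs = fst a \<and> last vs = fst b \<and>
           (\<forall>i\<in>{1..<length es}. vs ! i \<notin> T) \<and> es \<noteq> [] \<and> a \<in># halves G (hd es)"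
  using assms(1,2)
proof (induction rule: half_walk.induct)
  have halves: "halves G e = {#a, b#} \<and> ends G e = {#fst a, fst b#} \<and> fst a \<in> nodes G \<and> fst b \<in> nodes G"
    if "joins p q e a b" "e \<in> edges G" for e a b
  proof -
    have "halves G e = {#a, b#}" using pq[OF that(2)] that(1) by (auto simp: joins_def)
    then show ?thesis using assms(3) that(2) by (auto simp: ends_def finite_bidirected_graph_def)
  qed
  {
    case (single e a b)
    then show ?case using halves[OF single(1)]
      by (intro exI[of _ "[fst a, fst b]"]) (auto simp: is_walk_def)
  next
    case (step e a v d d' es b)
    then obtain vs where vs: "is_walk G vs es" "hd vs = v" "last vs = fst b"
      "\<forall>i\<in>{1..<length es}. vs ! i \<notin> T" "es \<noteq> []" "(v, d') \<in># halves G (hd es)" by auto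
    have e: "halves G e = {#a, (v, d)#}" "ends G e = {#fst a, v#}" "fst a \<in> nodes G"
      using halves[OF step(1)] step.prems by auto
    have len: "length vs = length es + 1" using vs(1) by (simp add: is_walk_def)
    have vs0: "vs ! 0 = v" "vs \<noteq> []" using vs(2) len by (cases vs; simp)+
    have "transit_pair G v e (es ! 0)"
      using e(1) vs(5,6) step.hyps(3) unfolding transit_pair_def enters_def leaves_def
      by (cases d; cases d') (auto simp: hd_conv_nth)
    then have "is_walk G (fst a # vs) (e # es)"
      using vs(1) e vs0 step.prems unfolding is_walk_iff
      by (auto simp: nth_Cons split: nat.splits)
    moreover have "\<forall>i\<in>{1..<length (e # es)}. (fst a # vs) ! i \<notin> T"
    proof
      fix i assume "i \<in> {1..<length (e # es)}"
      then obtain k where "i = Suc k" "k < length es" by (cases i) auto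
      then show "(fst a # vs) ! i \<notin> T"
        using vs(4) vs0 step.hyps(2) by (cases "k = 0") auto
    qed
    ultimately show ?case using vs0 vs(3) e(1) by (intro exI[of _ "fst a # vs"]) auto
  }
qed

section \<open>Upper bound by cuts\<close>

text \<open>The ends are distinct terminals and \<open>s\<close> is the only terminal in
  \<open>X\<close>, so exactly one end lies in \<open>X\<close> and some edge of the path
  crosses.\<close>

lemma T_path_meets_boundary:
  assumes "(vs, es) \<in> T_paths G T" "X \<inter> T = {s}" "s = hd vs \<or> s = last vs"
  shows "set es \<inter> boundary G X \<noteq> {}"
proof -
  have walk: "is_walk G vs es" and ends: "hd vs \<in> T" "last vs \<in> T" "hd vs \<noteq> last vs"
    using assms(1) by (auto simp: T_paths_def is_path_def)
  have len: "length vs = length es + 1" using walk by (simp add: is_walk_iff)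
  then have "hd vs = vs ! 0" "last vs = vs ! length es"
    by (auto simp: hd_conv_nth last_conv_nth simp flip: length_greater_0_conv)
  then have differ: "(vs ! 0 \<in> X) \<noteq> (vs ! length es \<in> X)"
    using ends assms(2,3) by (metis Int_iff singletonD singletonI)
  have "\<exists>i<length es. (vs ! i \<in> X) \<noteq> (vs ! Suc i \<in> X)"
  proof (rule ccontr)
    assume "\<not> ?thesis"
    then have "i \<le> length es \<Longrightarrow> (vs ! i \<in> X) = (vs ! 0 \<in> X)" for i
      by (induction i) auto
    then show False using differ by blast
  qed
  then obtain i where i: "i < length es" "(vs ! i \<in> X) \<noteq> (vs ! Suc i \<in> X)" by blast
  have e: "es ! i \<in> edges G" "ends G (es ! i) = {#vs ! i, vs ! Suc i#}"
    "vs ! i \<in> nodes G" "vs ! Suc i \<in> nodes G"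
    using walk i(1) len nth_mem[of i vs] nth_mem[of "Suc i" vs] nth_mem[of i es]
    by (auto simp: is_walk_iff)
  moreover have "ends G (es ! i) = {#vs ! Suc i, vs ! i#}"
    using e(2) by (simp add: add_mset_commute)
  ultimately have "es ! i \<in> boundary G X"
    using i(2) unfolding boundary_def by blast
  then show ?thesis using nth_mem[OF i(1)] by blast
qed

text \<open>The paths ending at \<open>s\<close> use different edges of a minimum cut of
  \<open>s\<close>. Summing over the terminals counts every path twice.\<close>

lemma edge_disjoint_T_paths_upper_bound:
  fixes G :: "('a, 'b) bidirected_graph"
  assumes G: "finite_bidirected_graph G" and T: "T \<subseteq> nodes G"
    and F: "finite F" "F \<subseteq> T_paths G T" "edge_disjoint F"
  shows "2 * card F \<le> (\<Sum>s\<in>T. min_cut G T s)"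
proof -
  have fin: "finite (edges G)" "finite T"
    using G T by (auto simp: finite_bidirected_graph_def finite_subset)
  have ends: "hd (fst p) \<in> T" "last (fst p) \<in> T" "hd (fst p) \<noteq> last (fst p)" if "p \<in> F" for p
    using that F(2) by (auto simp: T_paths_def)
  have le: "card {p \<in> F. s = hd (fst p) \<or> s = last (fst p)} \<le> min_cut G T s" (is "card ?A \<le> _")
    if s: "s \<in> T" for s
  proof -
    obtain X where X: "X \<inter> T = {s}" "min_cut G T s = card (boundary G X)"
      using Min_in[OF min_cut_wf[OF G T s]] by (auto simp: min_cut_def)
    define g where "g p = (SOME e. e \<in> set (snd p) \<inter> boundary G X)" for p :: "'a list \<times> 'b list"
    have g: "g p \<in> set (snd p)" "g p \<in> boundary G X" if "p \<in> ?A" for p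
    proof -
      have "set (snd p) \<inter> boundary G X \<noteq> {}"
        using T_path_meets_boundary[of "fst p" "snd p" G T X s] that F(2) X(1) by auto
      then have "g p \<in> set (snd p) \<inter> boundary G X" unfolding g_def by (rule some_in_eq[THEN iffD2])
      then show "g p \<in> set (snd p)" "g p \<in> boundary G X" by auto
    qed
    have "inj_on g ?A"
    proof (rule inj_onI)
      fix p r assume "p \<in> ?A" "r \<in> ?A" "g p = g r"
      then have "\<not> disjnt (set (snd p)) (set (snd r))" using g(1)[of p] g(1)[of r] by (auto simp: disjnt_iff)
      then show "p = r"
        using F(3) \<open>p \<in> ?A\<close> \<open>r \<in> ?A\<close> by (auto simp: edge_disjoint_def pairwise_def)
    qed
    moreover have "finite (boundary G X)" using fin by (simp add: boundary_def)
    moreover have "g ` ?A \<subseteq> boundary G X" using g(2) by blast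
    ultimately show ?thesis unfolding X(2) by (intro card_inj_on_le)
  qed
  have "(\<Sum>p\<in>F. \<Sum>s\<in>T. of_bool (s = hd (fst p) \<or> s = last (fst p))) = (\<Sum>p\<in>F. 2 :: nat)"
  proof (rule sum.cong[OF refl])
    fix p assume "p \<in> F"
    note p = ends[OF this]
    have "T \<inter> {s. s = hd (fst p) \<or> s = last (fst p)} = {hd (fst p), last (fst p)}"
      using p by auto
    then show "(\<Sum>s\<in>T. of_bool (s = hd (fst p) \<or> s = last (fst p))) = (2 :: nat)"
      using fin p by (simp del: of_bool_or_iff)
  qed
  then have "2 * card F = (\<Sum>s\<in>T. \<Sum>p\<in>F. of_bool (s = hd (fst p) \<or> s = last (fst p)))"
    by (subst sum.swap) (simp del: of_bool_or_iff)
  also have "\<dots> = (\<Sum>s\<in>T. card {p \<in> F. s = hd (fst p) \<or> s = last (fst p)})"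
    using F(1) by (simp add: Int_def del: of_bool_or_iff)
  also have "\<dots> \<le> (\<Sum>s\<in>T. min_cut G T s)" by (intro sum_mono le)
  finally show ?thesis .
qed

section \<open>Lower bound by a packing, and the equality\<close>

lemma edge_disjoint_T_paths_exist:
  assumes G: "finite_bidirected_graph G" and T: "T \<subseteq> nodes G" and Eul: "inner_Eulerian G T"
  shows "\<exists>F. finite F \<and> F \<subseteq> T_paths G T \<and> edge_disjoint F \<and>
           (\<Sum>s\<in>T. min_cut G T s) \<le> 2 * card F"
proof -
  have fin: "finite (edges G)" "finite T"
    using G T by (auto simp: finite_bidirected_graph_def finite_subset)
  have "\<exists>a b. halves G e = {#a, b#}" if "e \<in> edges G" for e
  proof -
    have "size (halves G e) = Suc (Suc 0)"
      using G that by (simp add: finite_bidirected_graph_def)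
    then obtain a N where N: "halves G e = add_mset a N" "size N = 1"
      using size_eq_Suc_imp_eq_union by fastforce
    then show ?thesis using size_1_singleton_mset[of N] by blast
  qed
  then obtain p q where pq: "\<And>e. e \<in> edges G \<Longrightarrow> halves G e = {#p e, q e#}" by metis
  have ends: "ends G e = {#fst (p e), fst (q e)#}" "fst (p e) \<in> nodes G" "fst (q e) \<in> nodes G"
    and loop: "is_loop G e \<longleftrightarrow> fst (p e) = fst (q e)"
    and no_directed_loop: "fst (p e) = fst (q e) \<Longrightarrow> p e = q e" if "e \<in> edges G" for e
  proof -
    show e: "ends G e = {#fst (p e), fst (q e)#}" using pq[OF that] by (simp add: ends_def)
    show "fst (p e) \<in> nodes G" "fst (q e) \<in> nodes G"
      using G e that by (auto simp: finite_bidirected_graph_def)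
    show loop: "is_loop G e \<longleftrightarrow> fst (p e) = fst (q e)"
      by (auto simp: is_loop_def e add_eq_conv_ex)
    assume *: "fst (p e) = fst (q e)"
    then have "\<not> (enters G e (fst (p e)) \<and> leaves G e (fst (p e)))"
      using G that loop by (auto simp: finite_bidirected_graph_def)
    then show "p e = q e"
      using * pq[OF that] unfolding enters_def leaves_def
      by (cases "p e"; cases "q e"; cases "snd (p e)"; cases "snd (q e)") auto
  qed
  let ?E = "edges G"
  \<comment> \<open>As a loop has two equal half-edges here, it contributes 2 or 0, in agreement
    with the degrees of the graph.\<close>
  have deg: "half_degree p q ?E a =
      card {e \<in> ?E. \<not> is_loop G e \<and> a \<in># halves G e} + 2 * card {e \<in> ?E. is_loop G e \<and> a \<in># halves G e}"
    for a
  proof -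
    have "half_degree p q ?E a = (\<Sum>e\<in>?E. of_bool (\<not> is_loop G e \<and> a \<in># halves G e)
        + 2 * of_bool (is_loop G e \<and> a \<in># halves G e))"
      unfolding half_degree_def
    proof (rule sum.cong[OF refl])
      fix e assume e: "e \<in> ?E"
      show "of_bool (p e = a) + of_bool (q e = a) = of_bool (\<not> is_loop G e \<and> a \<in># halves G e)
          + 2 * (of_bool (is_loop G e \<and> a \<in># halves G e) :: nat)"
        using pq[OF e] loop[OF e] no_directed_loop[OF e]
        by (cases "fst (p e) = fst (q e)") auto
    qed
    then show ?thesis using fin by (simp add: sum.distrib sum_distrib_left[symmetric] Int_def)
  qed
  \<comment> \<open>\<open>exists_packing\<close> asks for balance at all elements of the node type
    outside \<open>T\<close>; those that are not nodes of \<open>G\<close> have degree 0.\<close>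
  have balanced: "half_degree p q ?E (v, d) = half_degree p q ?E (v, d')" if "v \<notin> T" for v d d'
  proof -
    have "half_degree p q ?E (v, Entering) = half_degree p q ?E (v, Leaving)"
    proof (cases "v \<in> nodes G")
      case True
      then have "deg_in G v = deg_out G v" using Eul that by (simp add: inner_Eulerian_def)
      then show ?thesis by (simp add: deg deg_in_def deg_out_def enters_def leaves_def)
    next
      case False
      then have "half_degree p q ?E (v, c) = 0" for c
        using ends(2,3) unfolding half_degree_def by (intro sum.neutral) force
      then show ?thesis by simp
    qed
    then show ?thesis by (cases d; cases d') auto
  qed
  \<comment> \<open>Intersecting with \<open>nodes G\<close> links the arbitrary sets of
    \<open>exists_packing\<close> to the sets of nodes in \<open>min_cut\<close>.\<close>
  have boundary: "card (boundary G (X \<inter> nodes G)) = cut_size p q ?E X" for X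
  proof -
    have "(\<exists>u v. ends G e = {#u, v#} \<and> u \<in> X \<inter> nodes G \<and> v \<in> nodes G - X \<inter> nodes G) \<longleftrightarrow>
        separates X (fst (p e)) (fst (q e))" if e: "e \<in> ?E" for e
    proof -
      have "ends G e = {#u, v#} \<longleftrightarrow>
          u = fst (p e) \<and> v = fst (q e) \<or> u = fst (q e) \<and> v = fst (p e)" for u v
        using ends(1)[OF e] by (auto simp: add_eq_conv_ex)
      then have "(\<exists>u v. ends G e = {#u, v#} \<and> Q u v) \<longleftrightarrow>
          Q (fst (p e)) (fst (q e)) \<or> Q (fst (q e)) (fst (p e))" for Q
        by metis
      then show ?thesis using ends(2,3)[OF e] unfolding separates_def by auto
    qed
    then have "boundary G (X \<inter> nodes G) = {e \<in> ?E. separates X (fst (p e)) (fst (q e))}"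
      unfolding boundary_def by blast
    then show ?thesis using fin by (simp add: cut_size_def Int_def)
  qed
  have min_cut: "min_cut G T s \<le> cut_size p q ?E X" "even (cut_size p q ?E X + min_cut G T s)"
    if X: "X \<inter> T = {s}" for X s
  proof -
    have s: "s \<in> T" using X by blast
    have "(X \<inter> nodes G) \<inter> T = {s}" using X T by blast
    then show "min_cut G T s \<le> cut_size p q ?E X"
      unfolding min_cut_def boundary[symmetric] by (intro Min_le min_cut_wf[OF G T s]) blast
    \<comment> \<open>A minimizing set \<open>Y\<close> is itself a cut of \<open>s\<close>, so
      \<open>X\<close> and \<open>Y\<close> have cuts of the same parity.\<close>
    obtain Y where Y: "Y \<subseteq> nodes G" "Y \<inter> T = {s}" "min_cut G T s = card (boundary G Y)"
      using Min_in[OF min_cut_wf[OF G T s]] by (auto simp: min_cut_def)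
    then have "min_cut G T s = cut_size p q ?E Y" using boundary[of Y] by (simp add: Int_absorb2)
    then show "even (cut_size p q ?E X + min_cut G T s)"
      using even_cut_size[OF fin(1) balanced X] even_cut_size[OF fin(1) balanced Y(2)] by auto
  qed
  obtain I P where I: "I \<subseteq> ?E" "packing p q T ?E I P" "(\<Sum>s\<in>T. min_cut G T s) \<le> 2 * card I"
    using exists_packing[where l = "min_cut G T", OF fin min_cut balanced] by blast
  have "\<exists>vs. (vs, P i) \<in> T_paths G T" if i: "i \<in> I" for i
  proof -
    obtain a b where P: "distinct (P i)" "set (P i) \<subseteq> ?E" "half_walk p q T a (P i) b"
      "fst a \<in> T" "fst b \<in> T" "fst a \<noteq> fst b"
      using I(2) i unfolding packing_def by blast
    obtain vs where vs: "is_walk G vs (P i)" "hd vs = fst a" "last vs = fst b"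
      "\<forall>j\<in>{1..<length (P i)}. vs ! j \<notin> T"
      using half_walk_imp_walk[OF P(3,2) G pq] by blast
    have "vs ! j \<in> nodes G" if "j < length (P i)" for j
      using vs(1) that nth_mem[of j vs] by (auto simp: is_walk_def)
    then show ?thesis using P vs by (intro exI[of _ vs]) (auto simp: T_paths_def is_path_def)
  qed
  then obtain vs where vs: "\<And>i. i \<in> I \<Longrightarrow> (vs i, P i) \<in> T_paths G T" by metis
  have disj: "disjnt (set (P i)) (set (P j))" if "i \<in> I" "j \<in> I" "i \<noteq> j" for i j
    using I(2) that by (auto simp: packing_def pairwise_def)
  \<comment> \<open>Different indices give different paths, because their edge sets are disjoint and
    not empty; so no path is lost in passing to a set.\<close>
  have "inj_on (\<lambda>i. (vs i, P i)) I"
  proof (rule inj_onI)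
    fix i j assume "i \<in> I" "j \<in> I" "(vs i, P i) = (vs j, P j)"
    moreover have "set (P i) \<noteq> {}" using T_path_edges(1)[OF vs[OF \<open>i \<in> I\<close>]] by simp
    ultimately show "i = j" using disj[of i j] by (auto simp: disjnt_def)
  qed
  then have "card ((\<lambda>i. (vs i, P i)) ` I) = card I" by (rule card_image)
  moreover have "finite ((\<lambda>i. (vs i, P i)) ` I)" using I(1) fin by (simp add: finite_subset)
  moreover have "edge_disjoint ((\<lambda>i. (vs i, P i)) ` I)"
    unfolding edge_disjoint_def pairwise_def using disj by auto
  ultimately show ?thesis using I(3) vs by (intro exI[of _ "(\<lambda>i. (vs i, P i)) ` I"]) auto
qed

theorem theorem1p1:
  fixes G :: "('v, 'e) bidirected_graph" and T :: "'v set"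
  assumes "finite_bidirected_graph G"
    and "T \<subseteq> nodes G"
    and "inner_Eulerian G T"
  shows "real (max_T_paths G T) = 1 / 2 * (\<Sum>s\<in>T. real (min_cut G T s))"
proof -
  note wf = max_T_paths_wf[OF assms(1), of T]
  obtain F where "max_T_paths G T = card F" "finite F" "F \<subseteq> T_paths G T" "edge_disjoint F"
    using Max_in[OF wf] by (auto simp: max_T_paths_def)
  then have "2 * max_T_paths G T \<le> (\<Sum>s\<in>T. min_cut G T s)"
    using edge_disjoint_T_paths_upper_bound[OF assms(1,2)] by simp
  moreover obtain F' where F': "finite F'" "F' \<subseteq> T_paths G T" "edge_disjoint F'"
    "(\<Sum>s\<in>T. min_cut G T s) \<le> 2 * card F'"
    using edge_disjoint_T_paths_exist[OF assms] by blast
  moreover have "card F' \<le> max_T_paths G T"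
    unfolding max_T_paths_def using F' by (intro Max_ge wf) blast
  ultimately have "2 * max_T_paths G T = (\<Sum>s\<in>T. min_cut G T s)" by linarith
  then have "real (2 * max_T_paths G T) = (\<Sum>s\<in>T. real (min_cut G T s))" by simp
  then show ?thesis by simp
qed

end
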